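(* Fix a feasibility task given by a matrix $A\in\mathbb{R}^{m\times n}$, a vector $b\in\mathbb{R}^n$ and a scalar $\gamma\in\mathbb{R}$, and fix $\varepsilon>0$. Consider the MW–Oracle game for this task, and let $\rho>0$ be the width of the Oracle. Then MW has a strategy such that, after $4\varepsilon^{-2}\rho^2\ln(2m)$ rounds, either the Oracle has failed at least once, or MW computes $x_*\in\mathbb{R}^n$ satisfying $\|Ax_*\|_\infty+\langle b,x_*\rangle\le\gamma$. Moreover, this strategy of MW can be implemented by computing $O(1)$ basic vector operations per round.
   Context: The feasibility task asks for $x\in\mathbb{R}^n$ with $\|Ax\|_\infty+\langle b,x\rangle\le\gamma$. For $p\in\mathbb{R}^m$ with $\|p\|_1\le 1$ and $\varepsilon>0$, the linearized task asks for $x\in\mathbb{R}^n$ with $\langle p,Ax\rangle+\langle b,x\rangle\le\gamma-\varepsilon$. The MW–Oracle game is played for $T$ rounds: in each round $t$, MW (using only information received so far) computes $p_t\in\mathbb{R}^m$ with $\|p_t\|_1\le 1$ and asks the Oracle to solve the linearized task with parameters $(p_t,\varepsilon)$; the Oracle either returns a solution $x_t\in\mathbb{R}^n$ of that linearized task or fails (in which case the game stops). After $T$ rounds MW must output $x_*\in\mathbb{R}^n$. The width $\rho>0$ of the Oracle is any upper bound $\rho\ge\|Ax\|_\infty$ valid for every solution $x$ the Oracle may return. A basic vector operation is one of: assigning a vector in $\mathbb{R}^n$ or $\mathbb{R}^m$ to a variable, adding two vectors, applying a scalar function $\mathbb{R}\to\mathbb{R}$ coordinatewise, or computing a matrix–vector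 product with the input matrices (here $A$, $A^T$). *)

theory Defs
  imports Complex_Main "Jordan_Normal_Form.Matrix"
begin

definition l1_norm :: "real vec \<Rightarrow> real" where
  "l1_norm v = (\<Sum>i<dim_vec v. \<bar>v $ i\<bar>)"

(* The inserted 0 only matters for the empty vector. *)
definition linf_norm :: "real vec \<Rightarrow> real" where
  "linf_norm v = Max (insert 0 ((\<lambda>i. \<bar>v $ i\<bar>) ` {..<dim_vec v}))"

definition solves_feasibility :: "real mat \<Rightarrow> real vec \<Rightarrow> real \<Rightarrow> real vec \<Rightarrow> bool" where
  "solves_feasibility A b \<gamma> x \<longleftrightarrow>
     x \<in> carrier_vec (dim_col A) \<and> linf_norm (A *\<^sub>v x) + b \<bullet> x \<le> \<gamma>"

definition solves_linearized ::
  "real mat \<Rightarrow> real vec \<Rightarrow> real \<Rightarrow> real vec \<Rightarrow> real \<Rightarrow> real vec \<Rightarrow> bool" where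
  "solves_linearized A b \<gamma> p \<epsilon> x \<longleftrightarrow>
     x \<in> carrier_vec (dim_col A) \<and> p \<bullet> (A *\<^sub>v x) + b \<bullet> x \<le> \<gamma> - \<epsilon>"

definition legal_query :: "real mat \<Rightarrow> real vec \<Rightarrow> bool" where
  "legal_query A p \<longleftrightarrow> p \<in> carrier_vec (dim_row A) \<and> l1_norm p \<le> 1"


section \<open>The game\<close>

text \<open>
  An Oracle is given by the set of all reactions it may show to a query, where \<open>None\<close> stands
  for failure.  It is free to choose among them in every round, in particular depending on
  the course of the game so far.
\<close>

type_synonym oracle_reactions = "real vec \<Rightarrow> real vec option set"

definition is_oracle :: "real mat \<Rightarrow> real vec \<Rightarrow> real \<Rightarrow> real \<Rightarrow> oracle_reactions \<Rightarrow> bool" where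
  "is_oracle A b \<gamma> \<epsilon> Orc \<longleftrightarrow>
     (\<forall>p. legal_query A p \<longrightarrow>
        Orc p \<noteq> {} \<and> (\<forall>x. Some x \<in> Orc p \<longrightarrow> solves_linearized A b \<gamma> p \<epsilon> x))"

definition is_width :: "real mat \<Rightarrow> oracle_reactions \<Rightarrow> real \<Rightarrow> bool" where
  "is_width A Orc \<rho> \<longleftrightarrow>
     (\<forall>p x. legal_query A p \<and> Some x \<in> Orc p \<longrightarrow> linf_norm (A *\<^sub>v x) \<le> \<rho>)"

text \<open>
  Both components of a strategy take the list of the Oracle's answers received so far,
  oldest first.
\<close>

record strategy =
  query :: "real vec list \<Rightarrow> real vec"
  final_output :: "real vec list \<Rightarrow> real vec"

datatype game_state = Failed | Running "real vec list"

(* play S Orc t s: the game may be in state s after t rounds. *)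
inductive play :: "strategy \<Rightarrow> oracle_reactions \<Rightarrow> nat \<Rightarrow> game_state \<Rightarrow> bool"
  for S :: strategy and Orc :: oracle_reactions where
  start: "play S Orc 0 (Running [])"
| answer: "play S Orc t (Running xs) \<Longrightarrow> Some x \<in> Orc (query S xs) \<Longrightarrow>
           play S Orc (Suc t) (Running (xs @ [x]))"
| fail: "play S Orc t (Running xs) \<Longrightarrow> None \<in> Orc (query S xs) \<Longrightarrow>
         play S Orc (Suc t) Failed"
| stopped: "play S Orc t Failed \<Longrightarrow> play S Orc (Suc t) Failed"

definition mw_succeeds ::
  "real mat \<Rightarrow> real vec \<Rightarrow> real \<Rightarrow> oracle_reactions \<Rightarrow> nat \<Rightarrow> strategy \<Rightarrow> bool" where
  "mw_succeeds A b \<gamma> Orc T S \<longleftrightarrow>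
     (\<forall>t<T. \<forall>xs. play S Orc t (Running xs) \<longrightarrow> legal_query A (query S xs)) \<and>
     (\<forall>s. play S Orc T s \<longrightarrow>
        s = Failed \<or> (\<exists>xs. s = Running xs \<and> solves_feasibility A b \<gamma> (final_output S xs)))"


section \<open>Programs made of basic vector operations\<close>

text \<open>
  A program has variables for vectors in $R^n$ (space \<open>Rn\<close>) and in $R^m$ (space \<open>Rm\<close>).  It
  contains no reference to the matrix: the only access to \<open>A\<close> is by multiplying with \<open>A\<close> or
  its transpose.  The first variable index in an instruction is its target.

  \<open>Div_l1\<close> is the coordinatewise application of the scalar function $r \mapsto r / c$ where
  $c$ is the $1$-norm of a variable.  It is the only scalar function
  that may depend on data: the functions in \<open>Map\<close> and the constants in \<open>Set_const\<close>
  are part of the program text.  Scaling by such a data-dependent factor is needed to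
  meet the requirement that queries have $1$-norm at most $1$.
\<close>

datatype space = Rn | Rm

datatype instr =
    Set_const space nat "nat \<Rightarrow> real"
  | Copy space nat nat
  | Add space nat nat nat
  | Map space "real \<Rightarrow> real" nat nat
  | Div_l1 space nat nat nat
  | Mul_A nat nat
  | Mul_At nat nat

type_synonym store = "space \<Rightarrow> nat \<Rightarrow> real vec"

definition space_dim :: "real mat \<Rightarrow> space \<Rightarrow> nat" where
  "space_dim A s = (case s of Rn \<Rightarrow> dim_col A | Rm \<Rightarrow> dim_row A)"

definition assign :: "space \<Rightarrow> nat \<Rightarrow> real vec \<Rightarrow> store \<Rightarrow> store" where
  "assign s i v \<sigma> = \<sigma>(s := (\<sigma> s)(i := v))"

fun exec_instr :: "real mat \<Rightarrow> instr \<Rightarrow> store \<Rightarrow> store" where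
  "exec_instr A (Set_const s i c) \<sigma> = assign s i (vec (space_dim A s) c) \<sigma>"
| "exec_instr A (Copy s i j) \<sigma> = assign s i (\<sigma> s j) \<sigma>"
| "exec_instr A (Add s i j k) \<sigma> = assign s i (\<sigma> s j + \<sigma> s k) \<sigma>"
| "exec_instr A (Map s f i j) \<sigma> = assign s i (map_vec f (\<sigma> s j)) \<sigma>"
| "exec_instr A (Div_l1 s i j k) \<sigma> =
     assign s i (map_vec (\<lambda>r. r / l1_norm (\<sigma> s k)) (\<sigma> s j)) \<sigma>"
| "exec_instr A (Mul_A i j) \<sigma> = assign Rm i (A *\<^sub>v \<sigma> Rn j) \<sigma>"
| "exec_instr A (Mul_At i j) \<sigma> = assign Rn i (transpose_mat A *\<^sub>v \<sigma> Rm j) \<sigma>"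

definition exec :: "real mat \<Rightarrow> instr list \<Rightarrow> store \<Rightarrow> store" where
  "exec A is \<sigma> = fold (exec_instr A) is \<sigma>"

text \<open>
  All variables start as zero vectors.  In each round \<open>round_code\<close> is executed, the query is
  read from variable \<open>0\<close> of space \<open>Rm\<close>, and the Oracle's answer is assigned to variable \<open>0\<close>
  of space \<open>Rn\<close>.  After the last round \<open>final_code\<close> is executed and the output is read from
  variable \<open>0\<close> of space \<open>Rn\<close>.
\<close>

record program =
  round_code :: "instr list"
  final_code :: "instr list"

definition init_store :: "real mat \<Rightarrow> store" where
  "init_store A = (\<lambda>s i. 0\<^sub>v (space_dim A s))"

definition store_after :: "real mat \<Rightarrow> program \<Rightarrow> real vec list \<Rightarrow> store" where
  "store_after A P xs =
     foldl (\<lambda>\<sigma> x. assign Rn 0 x (exec A (round_code P) \<sigma>)) (init_store A) xs"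

definition program_strategy :: "real mat \<Rightarrow> program \<Rightarrow> strategy" where
  "program_strategy A P =
     \<lparr> query = (\<lambda>xs. exec A (round_code P) (store_after A P xs) Rm 0),
       final_output = (\<lambda>xs. exec A (final_code P) (store_after A P xs) Rn 0) \<rparr>"

(* The 1 accounts for assigning the Oracle's answer; the final code has to
   fit into the budget of a round as well. *)
definition ops_per_round :: "program \<Rightarrow> nat" where
  "ops_per_round P = max (length (round_code P) + 1) (length (final_code P))"

end

(* Multiplicative weights on the 2m experts (i, +) and (i, -): with s = A (x_1 + ... + x_t), their
   weights exp (eta s_i) and exp (- eta s_i) add up to the potential 2 sum_i cosh (eta s_i), and the
   query is sinh (eta s_i) / sum_j cosh (eta s_j).  For eta = eps / (2 rho^2) and eta rho <= 1, an
   answer x to the query p multiplies the potential by at most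
   exp (eta <p, A x> + eta^2 rho^2), where <p, A x> <= gamma - eps - <b, x>.  As the potential bounds
   exp (eta |s_i|), the mean of the answers is feasible as soon as t >= 4 rho^2 ln (2m) / eps^2.
   If eta rho > 1, then eps > 2 rho, and every single answer is already feasible. *)
theory Submission
  imports Defs
begin

section \<open>Norms\<close>

lemma abs_le_linf_norm: "i < dim_vec v \<Longrightarrow> \<bar>v $ i\<bar> \<le> linf_norm v"
  unfolding linf_norm_def by (intro Max_ge) auto

text \<open>Some coordinate exists, so the right side already forces \<open>c\<close> to be
  nonnegative, which covers the inserted 0.\<close>

lemma linf_norm_le_iff: "0 < dim_vec v \<Longrightarrow> linf_norm v \<le> c \<longleftrightarrow> (\<forall>i<dim_vec v. \<bar>v $ i\<bar> \<le> c)"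
  unfolding linf_norm_def using abs_ge_zero[of "v $ 0"] by (subst Max_le_iff) force+

lemma linf_norm_nonneg: "0 \<le> linf_norm v"
  unfolding linf_norm_def by (intro Max_ge) auto

text \<open>Hoelder's inequality for the dual pair of 1-norm and maximum norm.\<close>

lemma abs_scalar_prod_le:
  assumes "dim_vec p = dim_vec v"
  shows "\<bar>p \<bullet> v\<bar> \<le> l1_norm p * linf_norm v"
proof -
  have "\<bar>p \<bullet> v\<bar> \<le> (\<Sum>i<dim_vec v. \<bar>p $ i * v $ i\<bar>)"
    unfolding scalar_prod_def lessThan_atLeast0 by (rule sum_abs)
  also have "\<dots> \<le> (\<Sum>i<dim_vec v. \<bar>p $ i\<bar> * linf_norm v)"
    by (intro sum_mono) (auto simp: abs_mult intro: mult_left_mono abs_le_linf_norm)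
  finally show ?thesis
    using assms by (simp add: l1_norm_def sum_distrib_right)
qed


section \<open>The potential\<close>

text \<open>Half the total weight of the 2m experts; the factor 2 returns in
  \<open>play_bound\<close>.\<close>

definition potential :: "real \<Rightarrow> real vec \<Rightarrow> real" where
  "potential \<eta> s = (\<Sum>i<dim_vec s. cosh (\<eta> * s $ i))"

text \<open>The weight of (i, +) minus that of (i, -), over the total weight: the distribution on
  the experts, folded into a signed vector.\<close>

definition mw_query :: "real \<Rightarrow> real vec \<Rightarrow> real vec" where
  "mw_query \<eta> s = map_vec (\<lambda>r. sinh (\<eta> * r) / potential \<eta> s) s"

lemma dim_mw_query [simp]: "dim_vec (mw_query \<eta> s) = dim_vec s"
  by (simp add: mw_query_def)

lemma cosh_le_potential: "i < dim_vec s \<Longrightarrow> cosh (\<eta> * s $ i) \<le> potential \<eta> s"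
  unfolding potential_def by (rule member_le_sum) auto

lemma potential_nonneg: "0 \<le> potential \<eta> s"
  unfolding potential_def by (intro sum_nonneg) simp

lemma potential_pos: "0 < dim_vec s \<Longrightarrow> 0 < potential \<eta> s"
  using cosh_le_potential[of 0 s \<eta>] cosh_real_pos[of "\<eta> * s $ 0"] by linarith

lemma abs_sinh_le_cosh: "\<bar>sinh x\<bar> \<le> cosh (x::real)"
  by (simp add: abs_le_iff sinh_def cosh_def)

lemma l1_norm_mw_query_le: "l1_norm (mw_query \<eta> s) \<le> 1"
proof -
  have "l1_norm (mw_query \<eta> s) = (\<Sum>i<dim_vec s. \<bar>sinh (\<eta> * s $ i)\<bar>) / potential \<eta> s"
    by (simp add: l1_norm_def mw_query_def sum_divide_distrib potential_nonneg)
  also have "\<dots> \<le> potential \<eta> s / potential \<eta> s"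
    unfolding potential_def
    by (intro divide_right_mono sum_mono sum_nonneg abs_sinh_le_cosh) simp
  \<comment> \<open>The quotient is 1, except for the empty vector, where it is 0 / 0 = 0.\<close>
  finally show ?thesis
    by (simp split: if_splits)
qed

section \<open>Growth of the potential in one round\<close>

lemma exp_le_quadratic:
  fixes x :: real
  assumes "\<bar>x\<bar> \<le> 1"
  shows "exp x \<le> 1 + x + x\<^sup>2"
proof (cases "0 \<le> x")
  case True
  then show ?thesis
    using assms by (simp add: exp_bound)
next
  case False
  \<comment> \<open>For negative x, the claim follows from exp (- x) \<ge> 1 - x and this
    factorization of 1 - x^3, which is at least 1.\<close>
  have "(1 + (- x)) * (1 + x + x\<^sup>2) = 1 + (- x) ^ 3"
    by (simp add: power2_eq_square power3_eq_cube algebra_simps)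
  moreover have "0 \<le> (- x) ^ 3"
    using False by simp
  ultimately have "1 \<le> (1 + (- x)) * (1 + x + x\<^sup>2)"
    by linarith
  also have "\<dots> \<le> exp (- x) * (1 + x + x\<^sup>2)"
    using assms by (intro mult_right_mono exp_ge_add_one_self) (simp add: abs_le_iff)
  finally show ?thesis
    by (simp add: exp_minus field_simps)
qed

text \<open>Average the quadratic bounds at u and - u with the factors exp x and exp (- x): the even
  terms combine to cosh x, the linear ones to sinh x.\<close>

lemma cosh_add_le:
  fixes x u :: real
  assumes "\<bar>u\<bar> \<le> 1"
  shows "cosh (x + u) \<le> (1 + u\<^sup>2) * cosh x + u * sinh x"
proof -
  have "exp x * exp u \<le> exp x * (1 + u + u\<^sup>2)"
    and "exp (- x) * exp (- u) \<le> exp (- x) * (1 + (- u) + (- u)\<^sup>2)"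
    using exp_le_quadratic[of u] exp_le_quadratic[of "- u"] assms by simp_all
  then show ?thesis
    by (simp add: cosh_def sinh_def exp_add[symmetric] field_simps)
qed

text \<open>Applying \<open>cosh_add_le\<close> to each row, the sinh terms add up to the potential
  times the scalar product with the query, whose normalization cancels. Then 1 + y \<le> exp y makes
  the bound multiplicative, ready for iteration.\<close>

lemma potential_add_le:
  assumes dim: "dim_vec a = dim_vec s" and pos: "0 < dim_vec s" and "0 \<le> \<eta>"
    and width: "linf_norm a \<le> \<rho>" and small: "\<eta> * \<rho> \<le> 1"
  shows "potential \<eta> (s + a) \<le>
    potential \<eta> s * exp (\<eta> * (mw_query \<eta> s \<bullet> a) + (\<eta> * \<rho>)\<^sup>2)"
proof -
  have "potential \<eta> (s + a) \<le>
      (\<Sum>i<dim_vec s. (1 + (\<eta> * \<rho>)\<^sup>2) * cosh (\<eta> * s $ i) + \<eta> * (sinh (\<eta> * s $ i) * a $ i))"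
    unfolding potential_def
  proof (simp only: index_add_vec dim, rule sum_mono)
    fix i assume "i \<in> {..<dim_vec s}"
    then have i: "i < dim_vec s" "i < dim_vec a"
      using dim by simp_all
    have "\<bar>\<eta> * a $ i\<bar> \<le> \<eta> * \<rho>"
      using abs_le_linf_norm[OF i(2)] width \<open>0 \<le> \<eta>\<close>
      by (auto simp: abs_mult intro!: mult_left_mono)
    then have u: "\<bar>\<eta> * a $ i\<bar> \<le> 1" "(\<eta> * a $ i)\<^sup>2 \<le> (\<eta> * \<rho>)\<^sup>2"
      using small by (auto simp: abs_le_square_iff[symmetric])
    have "cosh (\<eta> * (s + a) $ i) = cosh (\<eta> * s $ i + \<eta> * a $ i)"
      using i by (simp add: algebra_simps)
    also have "\<dots> \<le> (1 + (\<eta> * a $ i)\<^sup>2) * cosh (\<eta> * s $ i) + \<eta> * a $ i * sinh (\<eta> * s $ i)"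
      by (rule cosh_add_le[OF u(1)])
    also have "\<dots> \<le> (1 + (\<eta> * \<rho>)\<^sup>2) * cosh (\<eta> * s $ i) + \<eta> * (sinh (\<eta> * s $ i) * a $ i)"
      using u(2) by (auto intro!: add_mono mult_right_mono)
    finally show "cosh (\<eta> * (s + a) $ i) \<le> \<dots>" .
  qed
  also have "\<dots> = potential \<eta> s * (1 + (\<eta> * (mw_query \<eta> s \<bullet> a) + (\<eta> * \<rho>)\<^sup>2))"
  proof -
    have "potential \<eta> s * (mw_query \<eta> s \<bullet> a) = (\<Sum>i<dim_vec s. sinh (\<eta> * s $ i) * a $ i)"
      using potential_pos[OF pos, of \<eta>] dim
      by (simp add: scalar_prod_def mw_query_def lessThan_atLeast0 sum_distrib_left)
    then show ?thesis
      by (simp add: sum.distrib sum_distrib_left[symmetric] potential_def[symmetric] algebra_simps)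
  qed
  also have "\<dots> \<le> potential \<eta> s * exp (\<eta> * (mw_query \<eta> s \<bullet> a) + (\<eta> * \<rho>)\<^sup>2)"
    by (intro mult_left_mono exp_ge_add_one_self potential_nonneg)
  finally show ?thesis .
qed


section \<open>The program\<close>

definition answer_sum :: "nat \<Rightarrow> real vec list \<Rightarrow> real vec" where
  "answer_sum n xs = foldl (+) (0\<^sub>v n) xs"

lemma answer_sum_Nil [simp]: "answer_sum n [] = 0\<^sub>v n"
  by (simp add: answer_sum_def)

lemma answer_sum_snoc [simp]: "answer_sum n (xs @ [x]) = answer_sum n xs + x"
  by (simp add: answer_sum_def)

text \<open>
  An answer is added to the running sum only by the next round or by the final code; hence the
  first round adds the initial zero vector.
\<close>

definition mw_program :: "real \<Rightarrow> nat \<Rightarrow> program" where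
  "mw_program \<eta> T =
     \<lparr> round_code =
         [Add Rn 1 1 0,
          Mul_A 1 1,
          Map Rm (\<lambda>r. sinh (\<eta> * r)) 0 1,
          Map Rm (\<lambda>r. cosh (\<eta> * r)) 2 1,
          Div_l1 Rm 0 0 2],
       final_code =
         [Add Rn 1 1 0,
          Map Rn (\<lambda>r. r / real T) 0 1] \<rparr>"

text \<open>Five instructions and the assignment of the answer.\<close>

lemma ops_mw_program: "ops_per_round (mw_program \<eta> T) = 6"
  by (simp add: ops_per_round_def mw_program_def)

text \<open>Variable 1 lags one answer behind and variable 0 holds the latest answer. Only their sum
  is tracked, as both codes begin by computing it.\<close>

lemma store_after_mw_program:
  "store_after A (mw_program \<eta> T) xs Rn 1 + store_after A (mw_program \<eta> T) xs Rn 0 =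
     answer_sum (dim_col A) xs"
proof (induction xs rule: rev_induct)
  case Nil
  then show ?case
    by (simp add: store_after_def init_store_def space_dim_def)
next
  case (snoc x xs)
  have "store_after A (mw_program \<eta> T) (xs @ [x]) =
      assign Rn 0 x (exec A (round_code (mw_program \<eta> T)) (store_after A (mw_program \<eta> T) xs))"
    by (simp add: store_after_def)
  then show ?case
    using snoc by (simp add: mw_program_def exec_def assign_def)
qed

lemma query_mw_program:
  "query (program_strategy A (mw_program \<eta> T)) xs = mw_query \<eta> (A *\<^sub>v answer_sum (dim_col A) xs)"
proof -
  \<comment> \<open>As cosh is positive, the 1-norm of the cosh vector is the potential, so
    \<open>Div_l1\<close> performs the normalization.\<close>
  have "l1_norm (map_vec (\<lambda>r. cosh (\<eta> * r)) s) = potential \<eta> s" for s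
    by (simp add: l1_norm_def potential_def)
  then show ?thesis
    using store_after_mw_program[of A \<eta> T xs]
    by (intro eq_vecI)
      (simp_all add: program_strategy_def mw_program_def exec_def assign_def mw_query_def)
qed

lemma output_mw_program:
  "final_output (program_strategy A (mw_program \<eta> T)) xs =
     (1 / real T) \<cdot>\<^sub>v answer_sum (dim_col A) xs"
  using store_after_mw_program[of A \<eta> T xs]
  by (intro eq_vecI) (simp_all add: program_strategy_def mw_program_def exec_def assign_def)


section \<open>The game\<close>

text \<open>\<eta> is left free here; its value enters only with \<open>play_bound\<close>.\<close>

locale mw_game =
  fixes A :: "real mat" and b :: "real vec" and \<gamma> \<epsilon> \<rho> \<eta> :: real
    and Orc :: oracle_reactions and T :: nat
  assumes rows: "0 < dim_row A"
    and b: "b \<in> carrier_vec (dim_col A)"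
    and is_oracle: "is_oracle A b \<gamma> \<epsilon> Orc"
    and is_width: "is_width A Orc \<rho>"
begin

abbreviation "S \<equiv> program_strategy A (mw_program \<eta> T)"
abbreviation "X \<equiv> answer_sum (dim_col A)"

section \<open>Invariants of a play\<close>

lemma legal: "legal_query A (query S xs)"
  unfolding legal_query_def query_mw_program
  by (intro conjI carrier_vecI l1_norm_mw_query_le) simp

lemma answer_facts:
  assumes "Some x \<in> Orc (query S xs)"
  shows "x \<in> carrier_vec (dim_col A)"
    and "query S xs \<bullet> (A *\<^sub>v x) + b \<bullet> x \<le> \<gamma> - \<epsilon>"
    and "linf_norm (A *\<^sub>v x) \<le> \<rho>"
  using assms is_oracle is_width legal[of xs]
  unfolding is_oracle_def is_width_def solves_linearized_def by blast+

text \<open>A running state has only running predecessors, so failure never enters the induction.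
  The rule also carries the dimension of the answer sum, which every linearity step needs.\<close>

lemma play_induct [consumes 1, case_names start answer]:
  assumes "play S Orc t (Running xs)"
    and start: "P 0 []"
    and answer: "\<And>t xs x. P t xs \<Longrightarrow> X xs \<in> carrier_vec (dim_col A) \<Longrightarrow>
      Some x \<in> Orc (query S xs) \<Longrightarrow> P (Suc t) (xs @ [x])"
  shows "X xs \<in> carrier_vec (dim_col A)" and "P t xs"
proof -
  have "X xs \<in> carrier_vec (dim_col A) \<and> P t xs"
    using assms(1)
  proof (induction t "Running xs" arbitrary: xs rule: play.induct)
    case start
    then show ?case
      using assms(2) by simp
  next
    case (answer t xs x)
    then show ?case
      using assms(3) answer_facts(1)[OF answer(3)] by simp
  qed
  then show "X xs \<in> carrier_vec (dim_col A)" and "P t xs"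
    by auto
qed

text \<open>Iterates \<open>potential_add_le\<close> from the value m at the zero vector, where
  every cosh is 1; the Oracle's inequality bounds the scalar product in each exponent.\<close>

lemma play_potential:
  assumes "play S Orc t (Running xs)" and "0 \<le> \<eta>" and "\<eta> * \<rho> \<le> 1"
  shows "potential \<eta> (A *\<^sub>v X xs) \<le>
    real (dim_row A) * exp (\<eta> * (t * (\<gamma> - \<epsilon>) - b \<bullet> X xs) + t * (\<eta> * \<rho>)\<^sup>2)"
  using assms(1)
proof (induction rule: play_induct(2))
  case start
  then show ?case
    using b by (simp add: potential_def)
next
  case (answer t xs x)
  note x = answer_facts[OF answer(3)]
  let ?c = "\<eta> * (real t * (\<gamma> - \<epsilon>) - b \<bullet> X xs) + real t * (\<eta> * \<rho>)\<^sup>2"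
  let ?q = "query S xs \<bullet> (A *\<^sub>v x)"
  have q: "\<eta> * ?q \<le> \<eta> * (\<gamma> - \<epsilon> - b \<bullet> x)"
    using x(2) \<open>0 \<le> \<eta>\<close> by (intro mult_left_mono) auto
  have "A *\<^sub>v X (xs @ [x]) = A *\<^sub>v X xs + A *\<^sub>v x"
    using answer(2) x(1) by (simp add: mult_add_distrib_mat_vec[of A "dim_row A" "dim_col A"])
  then have "potential \<eta> (A *\<^sub>v X (xs @ [x])) \<le>
      potential \<eta> (A *\<^sub>v X xs) * exp (\<eta> * ?q + (\<eta> * \<rho>)\<^sup>2)"
    using potential_add_le[of "A *\<^sub>v x" "A *\<^sub>v X xs" \<eta> \<rho>] assms(2,3) x(3) rows
    by (simp add: query_mw_program)
  also have "\<dots> \<le> potential \<eta> (A *\<^sub>v X xs) * exp (\<eta> * (\<gamma> - \<epsilon> - b \<bullet> x) + (\<eta> * \<rho>)\<^sup>2)"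
    using q by (intro mult_left_mono potential_nonneg) simp
  also have "\<dots> \<le> real (dim_row A) * exp ?c * exp (\<eta> * (\<gamma> - \<epsilon> - b \<bullet> x) + (\<eta> * \<rho>)\<^sup>2)"
    by (intro mult_right_mono answer(1)) simp
  also have "\<dots> = real (dim_row A) *
      exp (\<eta> * (real (Suc t) * (\<gamma> - \<epsilon>) - b \<bullet> X (xs @ [x])) + real (Suc t) * (\<eta> * \<rho>)\<^sup>2)"
    using b answer(2) x(1)
    by (simp add: scalar_prod_add_distrib[of b "dim_col A"] exp_add[symmetric] algebra_simps)
  finally show ?case .
qed

text \<open>Serves the case \<epsilon> > 2 \<rho>. The width is paid twice per answer: once by
  Hoelder to bound \<open>b \<bullet> x\<close>, once for row i itself.\<close>

lemma play_small_width:
  assumes "play S Orc t (Running xs)" and "i < dim_row A"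
  shows "\<bar>(A *\<^sub>v X xs) $ i\<bar> + b \<bullet> X xs \<le> t * (\<gamma> - \<epsilon> + 2 * \<rho>)"
  using assms(1)
proof (induction rule: play_induct(2))
  case start
  then show ?case
    using b assms(2) by simp
next
  case (answer t xs x)
  note x = answer_facts[OF answer(3)]
  have "\<bar>query S xs \<bullet> (A *\<^sub>v x)\<bar> \<le> l1_norm (query S xs) * linf_norm (A *\<^sub>v x)"
    by (rule abs_scalar_prod_le) (simp add: query_mw_program)
  also have "\<dots> \<le> 1 * linf_norm (A *\<^sub>v x)"
    by (intro mult_right_mono linf_norm_nonneg) (simp add: query_mw_program l1_norm_mw_query_le)
  finally have "b \<bullet> x \<le> \<gamma> - \<epsilon> + \<rho>"
    using x(2,3) by linarith
  moreover have "\<bar>(A *\<^sub>v x) $ i\<bar> \<le> \<rho>"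
    using abs_le_linf_norm[of i "A *\<^sub>v x"] assms(2) x(3) by simp
  moreover have "(A *\<^sub>v X (xs @ [x])) $ i = (A *\<^sub>v X xs) $ i + (A *\<^sub>v x) $ i"
    using answer(2) x(1) assms(2)
    by (simp add: mult_add_distrib_mat_vec[of A "dim_row A" "dim_col A"] del: index_mult_mat_vec)
  moreover have "b \<bullet> X (xs @ [x]) = b \<bullet> X xs + b \<bullet> x"
    using b answer(2) x(1) by (simp add: scalar_prod_add_distrib[of b "dim_col A"])
  ultimately show ?case
    using answer(1) by (simp add: algebra_simps)
qed

section \<open>From the invariants to a feasible mean\<close>

lemma play_bound:
  assumes play: "play S Orc T (Running xs)" and i: "i < dim_row A"
    and "0 < \<epsilon>" and "0 < \<rho>" and eta: "\<eta> = \<epsilon> / (2 * \<rho>\<^sup>2)"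
    and T: "4 * \<rho>\<^sup>2 / \<epsilon>\<^sup>2 * ln (2 * real (dim_row A)) \<le> T"
  shows "\<bar>(A *\<^sub>v X xs) $ i\<bar> + b \<bullet> X xs \<le> T * \<gamma>"
proof (cases "\<epsilon> \<le> 2 * \<rho>")
  case True
  let ?s = "A *\<^sub>v X xs" and ?m = "real (dim_row A)"
  have "0 < \<eta>" and small: "\<eta> * \<rho> \<le> 1"
    using True \<open>0 < \<epsilon>\<close> \<open>0 < \<rho>\<close> by (auto simp: eta power2_eq_square field_simps)
  have m: "0 < ?m"
    using rows by simp
  \<comment> \<open>One of the two exponentials in 2 cosh is the exponential of the absolute value,
    so both signs are treated at once.\<close>
  have "exp \<bar>\<eta> * ?s $ i\<bar> \<le> 2 * cosh (\<eta> * ?s $ i)"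
    by (simp add: cosh_def abs_if)
  also have "\<dots> \<le> 2 * potential \<eta> ?s"
    using cosh_le_potential[of i ?s \<eta>] i by simp
  also have "\<dots> \<le> 2 * ?m * exp (\<eta> * (T * (\<gamma> - \<epsilon>) - b \<bullet> X xs) + T * (\<eta> * \<rho>)\<^sup>2)"
    using play_potential[OF play _ small] \<open>0 < \<eta>\<close> by simp
  also have "\<dots> = exp (ln (2 * ?m) + (\<eta> * (T * (\<gamma> - \<epsilon>) - b \<bullet> X xs) + T * (\<eta> * \<rho>)\<^sup>2))"
    using m by (simp add: exp_add)
  finally have "\<eta> * \<bar>?s $ i\<bar> \<le> ln (2 * ?m) + (\<eta> * (T * (\<gamma> - \<epsilon>) - b \<bullet> X xs) + T * (\<eta> * \<rho>)\<^sup>2)"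
    using \<open>0 < \<eta>\<close> by (simp add: abs_mult)
  \<comment> \<open>The gain \<eta> T \<epsilon> splits into halves: by the choice of \<eta>, the
    second-order error is exactly one half; by the number of rounds, ln (2m) is at most the
    other.\<close>
  moreover have "T * (\<eta> * \<rho>)\<^sup>2 = T * (\<eta> * (\<epsilon> / 2))"
    using \<open>0 < \<rho>\<close> by (simp add: eta power2_eq_square)
  moreover have "ln (2 * ?m) \<le> T * (\<eta> * (\<epsilon> / 2))"
    using T \<open>0 < \<epsilon>\<close> \<open>0 < \<rho>\<close> by (simp add: eta power2_eq_square field_simps)
  moreover have "\<eta> * (T * (\<gamma> - \<epsilon>) - b \<bullet> X xs) + 2 * (T * (\<eta> * (\<epsilon> / 2))) =
      \<eta> * (T * \<gamma>) - \<eta> * (b \<bullet> X xs)"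
    by (simp add: algebra_simps)
  ultimately have "\<eta> * \<bar>?s $ i\<bar> + \<eta> * (b \<bullet> X xs) \<le> \<eta> * (T * \<gamma>)"
    by linarith
  then show ?thesis
    using \<open>0 < \<eta>\<close> by (simp add: distrib_left[symmetric])
next
  case False
  have "T * (\<gamma> - \<epsilon> + 2 * \<rho>) \<le> T * \<gamma>"
    using False by (intro mult_left_mono) auto
  then show ?thesis
    using play_small_width[OF play i] by linarith
qed

lemma succeeds:
  assumes "0 < \<epsilon>" and "0 < \<rho>" and eta: "\<eta> = \<epsilon> / (2 * \<rho>\<^sup>2)"
    and T: "4 * \<rho>\<^sup>2 / \<epsilon>\<^sup>2 * ln (2 * real (dim_row A)) \<le> T"
  shows "mw_succeeds A b \<gamma> Orc T S"
proof -
  \<comment> \<open>Since 2m \<ge> 2, the logarithm is positive; hence T > 0 and the mean of the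
    answers makes sense.\<close>
  have "0 < 4 * \<rho>\<^sup>2 / \<epsilon>\<^sup>2 * ln (2 * real (dim_row A))"
    using assms(1,2) rows by (intro mult_pos_pos) auto
  then have "0 < real T"
    using T by linarith
  have "solves_feasibility A b \<gamma> (final_output S xs)" if play: "play S Orc T (Running xs)" for xs
  proof -
    have X: "X xs \<in> carrier_vec (dim_col A)"
      \<comment> \<open>Only the dimension is wanted, so the predicate is trivial.\<close>
      using play by (rule play_induct(1)[where P = "\<lambda>_ _. True"]) auto
    have scaled: "A *\<^sub>v ((1 / T) \<cdot>\<^sub>v X xs) = (1 / T) \<cdot>\<^sub>v (A *\<^sub>v X xs)"
      "b \<bullet> ((1 / T) \<cdot>\<^sub>v X xs) = (1 / T) * (b \<bullet> X xs)"
      using X b by (auto simp: mult_mat_vec[of A "dim_row A" "dim_col A"])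
    have "linf_norm ((1 / T) \<cdot>\<^sub>v (A *\<^sub>v X xs)) \<le> \<gamma> - (1 / T) * (b \<bullet> X xs)"
    proof (subst linf_norm_le_iff, use rows in simp, intro allI impI)
      fix i assume "i < dim_vec ((1 / T) \<cdot>\<^sub>v (A *\<^sub>v X xs))"
      then have i: "i < dim_row A"
        by simp
      then have "\<bar>((1 / T) \<cdot>\<^sub>v (A *\<^sub>v X xs)) $ i\<bar> = \<bar>(A *\<^sub>v X xs) $ i\<bar> / T"
        by (simp add: abs_mult)
      also have "\<dots> \<le> \<gamma> - (1 / T) * (b \<bullet> X xs)"
        using play_bound[OF play i assms] \<open>0 < real T\<close> by (simp add: field_simps)
      finally show "\<bar>((1 / T) \<cdot>\<^sub>v (A *\<^sub>v X xs)) $ i\<bar> \<le> \<gamma> - (1 / T) * (b \<bullet> X xs)" .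
    qed
    then show ?thesis
      using X scaled by (simp add: solves_feasibility_def output_mw_program)
  qed
  then show ?thesis
    unfolding mw_succeeds_def by (metis game_state.exhaust legal)
qed

end

theorem theorem2p1:
  shows "\<exists>C :: nat. \<forall>(m :: nat) (n :: nat) (\<epsilon> :: real) (\<rho> :: real).
    m \<ge> 1 \<and> \<epsilon> > 0 \<and> \<rho> > 0 \<longrightarrow>
    (\<exists>P. ops_per_round P \<le> C \<and>
      (\<forall>A b \<gamma> Orc.
         A \<in> carrier_mat m n \<and> b \<in> carrier_vec n \<and>
         is_oracle A b \<gamma> \<epsilon> Orc \<and> is_width A Orc \<rho> \<longrightarrow>
         mw_succeeds A b \<gamma> Orc (nat \<lceil>4 * \<rho>\<^sup>2 / \<epsilon>\<^sup>2 * ln (2 * real m)\<rceil>) (program_strategy A P)))"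
proof (intro exI[of _ 6] allI impI, elim conjE)
  fix m n :: nat and \<epsilon> \<rho> :: real
  assume pos: "1 \<le> m" "0 < \<epsilon>" "0 < \<rho>"
  \<comment> \<open>T and \<eta> depend only on m, \<epsilon> and \<rho>, so one program serves
    every \<open>A\<close>, \<open>b\<close>, \<gamma> and \<open>Orc\<close>.\<close>
  define T where "T = nat \<lceil>4 * \<rho>\<^sup>2 / \<epsilon>\<^sup>2 * ln (2 * real m)\<rceil>"
  define \<eta> where "\<eta> = \<epsilon> / (2 * \<rho>\<^sup>2)"
  have T: "4 * \<rho>\<^sup>2 / \<epsilon>\<^sup>2 * ln (2 * real m) \<le> T"
    unfolding T_def by (rule real_nat_ceiling_ge)
  have "mw_succeeds A b \<gamma> Orc T (program_strategy A (mw_program \<eta> T))"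
    if "A \<in> carrier_mat m n" "b \<in> carrier_vec n" "is_oracle A b \<gamma> \<epsilon> Orc" "is_width A Orc \<rho>"
    for A b \<gamma> Orc
  proof -
    interpret mw_game A b \<gamma> \<epsilon> \<rho> \<eta> Orc T
      using that pos by unfold_locales auto
    show ?thesis
      using succeeds pos T that(1) by (simp add: \<eta>_def)
  qed
  then show "\<exists>P. ops_per_round P \<le> 6 \<and>
      (\<forall>A b \<gamma> Orc.
         A \<in> carrier_mat m n \<and> b \<in> carrier_vec n \<and>
         is_oracle A b \<gamma> \<epsilon> Orc \<and> is_width A Orc \<rho> \<longrightarrow>
         mw_succeeds A b \<gamma> Orc (nat \<lceil>4 * \<rho>\<^sup>2 / \<epsilon>\<^sup>2 * ln (2 * real m)\<rceil>) (program_strategy A P))"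
    unfolding T_def[symmetric] by (intro exI[of _ "mw_program \<eta> T"]) (simp add: ops_mw_program)
qed

end
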